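(* Let $X := \mathcal{C}([0,+\infty)) \cap L^1([0,+\infty))$, endowed with the metric $$d_X(f,g) := \|f-g\|_{L^1} + \sum_{n=1}^{\infty} \frac{1}{2^n}\cdot \frac{\|f-g\|_{\infty,n}}{1+\|f-g\|_{\infty,n}},\qquad \|f\|_{\infty,n} = \max\{|f(x)| : x\in[0,n]\},$$ and let $$\mathcal{A} = \left\{ f \in X : \limsup_{x \to +\infty} |f(x)| = +\infty \right\}.$$ Then $\mathcal{A}$ is maximal dense-lineable in $X$; that is, there is a vector subspace $M\subset X$, dense in $(X,d_X)$, with $\dim(M)=\dim(X)$ and $M\setminus\{0\}\subset\mathcal{A}$.
   Context: $\mathcal{C}([0,+\infty))$ is the real vector space of all continuous functions $[0,+\infty)\to\mathbb{R}$, and $L^1([0,+\infty))$ is the space of Lebesgue integrable functions on $[0,+\infty)$ with $\|f\|_{L^1}=\int_0^\infty |f(x)|\,dx$. Dimension means algebraic (Hamel) dimension over $\mathbb{R}$. $(X,d_X)$ is a metrizable topological vector space. A subset $A$ of a topological vector space $X$ is maximal dense-lineable if there is a dense vector subspace $M$ of $X$ with $M\setminus\{0\}\subset A$ and $\dim(M)=\dim(X)$. *)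

theory Defs
  imports "HOL-Analysis.Analysis" "HOL-Library.Equipollence"
begin

class topological_real_vector = real_vector + topological_ab_group_add +
  assumes tendsto_scaleR_Pair:
    "LIM x (nhds c \<times>\<^sub>F nhds v). fst x *\<^sub>R snd x :> nhds (c *\<^sub>R v)"

definition hamel_basis_of :: "'a::real_vector set \<Rightarrow> 'a set \<Rightarrow> bool" where
  "hamel_basis_of B S \<longleftrightarrow> independent B \<and> span B = S"

(* The library function dim is 0 on every infinite-dimensional space, so dimensions are
   compared as cardinals, through equipollence of Hamel bases. *)
definition same_dimension :: "'a::real_vector set \<Rightarrow> 'b::real_vector set \<Rightarrow> bool" where
  "same_dimension S T \<longleftrightarrow> (\<exists>B C. hamel_basis_of B S \<and> hamel_basis_of C T \<and> B \<approx> C)"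

definition maximal_dense_lineable :: "'a::topological_real_vector set \<Rightarrow> bool" where
  "maximal_dense_lineable A \<longleftrightarrow>
     (\<exists>M. subspace M \<and> closure M = UNIV \<and> M - {0} \<subseteq> A \<and> same_dimension M (UNIV :: 'a set))"

(* The space of continuous Lebesgue integrable functions on the half-line. A function on
   {0..} is represented by its extension by 0 to the negative reals; the extension carries no
   information and need not be continuous at 0 from the left. *)
typedef cont_L1 =
  "{f :: real \<Rightarrow> real. continuous_on {0..} f \<and> f absolutely_integrable_on {0..} \<and> (\<forall>x<0. f x = 0)}"
  morphisms fun_of Cont_L1
  by (rule exI[of _ "\<lambda>_. 0"]) auto

setup_lifting type_definition_cont_L1

instantiation cont_L1 :: real_vector
begin

lift_definition zero_cont_L1 :: cont_L1 is "\<lambda>_. 0"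
  by auto

lift_definition plus_cont_L1 :: "cont_L1 \<Rightarrow> cont_L1 \<Rightarrow> cont_L1" is "\<lambda>f g x. f x + g x"
  by (auto intro!: continuous_intros set_integral_add(1))

lift_definition minus_cont_L1 :: "cont_L1 \<Rightarrow> cont_L1 \<Rightarrow> cont_L1" is "\<lambda>f g x. f x - g x"
  by (auto intro!: continuous_intros set_integral_diff(1))

lift_definition uminus_cont_L1 :: "cont_L1 \<Rightarrow> cont_L1" is "\<lambda>f x. - f x"
  by (auto intro!: continuous_intros simp: set_integrable_def)

lift_definition scaleR_cont_L1 :: "real \<Rightarrow> cont_L1 \<Rightarrow> cont_L1" is "\<lambda>c f x. c * f x"
  by (auto intro!: continuous_intros)

instance
  by standard (transfer; auto simp: algebra_simps)+

end

lemma cont_L1_eqI: "(\<And>x. x \<ge> 0 \<Longrightarrow> fun_of f x = fun_of g x) \<Longrightarrow> f = g"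
  by transfer (metis ext not_le)

lemma continuous_on_fun_of: "continuous_on {0..} (fun_of f)"
  using fun_of[of f] by auto

lemma absolutely_integrable_fun_of: "fun_of f absolutely_integrable_on {0..}"
  using fun_of[of f] by auto

lemma set_integrable_abs_fun_of: "set_integrable lebesgue {0..} (\<lambda>x. \<bar>fun_of f x\<bar>)"
  using set_integrable_abs[OF absolutely_integrable_fun_of] .

definition L1_norm :: "cont_L1 \<Rightarrow> real" where
  "L1_norm f = (LINT x:{0..}|lebesgue. \<bar>fun_of f x\<bar>)"

(* The supremum is attained, as f is continuous on the compact interval. *)
definition sup_norm :: "nat \<Rightarrow> cont_L1 \<Rightarrow> real" where
  "sup_norm n f = (SUP x\<in>{0..real n}. \<bar>fun_of f x\<bar>)"

lemma bdd_above_fun_of: "bdd_above ((\<lambda>x. \<bar>fun_of f x\<bar>) ` {0..real n})"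
proof -
  have "continuous_on {0..real n} (\<lambda>x. \<bar>fun_of f x\<bar>)"
    by (intro continuous_intros continuous_on_subset[OF continuous_on_fun_of]) auto
  then show ?thesis
    by (intro bounded_imp_bdd_above compact_imp_bounded compact_continuous_image) auto
qed

lemma sup_norm_attained: "\<exists>x\<in>{0..real n}. sup_norm n f = \<bar>fun_of f x\<bar>"
proof -
  have "continuous_on {0..real n} (\<lambda>x. \<bar>fun_of f x\<bar>)"
    by (intro continuous_intros continuous_on_subset[OF continuous_on_fun_of]) auto
  from continuous_attains_sup[OF _ _ this]
  obtain x where x: "x \<in> {0..real n}" "\<And>y. y \<in> {0..real n} \<Longrightarrow> \<bar>fun_of f y\<bar> \<le> \<bar>fun_of f x\<bar>"
    by auto
  have "sup_norm n f = \<bar>fun_of f x\<bar>"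
    unfolding sup_norm_def
    by (rule antisym) (use x in \<open>auto intro!: cSUP_least cSUP_upper bdd_above_fun_of\<close>)
  with x(1) show ?thesis by blast
qed

lemma fun_of_le_sup_norm: "x \<in> {0..real n} \<Longrightarrow> \<bar>fun_of f x\<bar> \<le> sup_norm n f"
  unfolding sup_norm_def by (intro cSUP_upper bdd_above_fun_of)

lemma sup_norm_nonneg [simp]: "0 \<le> sup_norm n f"
  using sup_norm_attained[of n f] by auto

lemma sup_norm_triangle: "sup_norm n (f + g) \<le> sup_norm n f + sup_norm n g"
proof -
  obtain x where x: "x \<in> {0..real n}" "sup_norm n (f + g) = \<bar>fun_of (f + g) x\<bar>"
    using sup_norm_attained by blast
  have "fun_of (f + g) x = fun_of f x + fun_of g x"
    by transfer simp
  with x(2) fun_of_le_sup_norm[OF x(1), of f] fun_of_le_sup_norm[OF x(1), of g]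
  show ?thesis by linarith
qed

lemma sup_norm_scaleR: "sup_norm n (c *\<^sub>R f) = \<bar>c\<bar> * sup_norm n f"
proof (rule antisym)
  have *: "fun_of (c *\<^sub>R f) x = c * fun_of f x" for x
    by transfer simp
  obtain x where x: "x \<in> {0..real n}" "sup_norm n (c *\<^sub>R f) = \<bar>fun_of (c *\<^sub>R f) x\<bar>"
    using sup_norm_attained by blast
  show "sup_norm n (c *\<^sub>R f) \<le> \<bar>c\<bar> * sup_norm n f"
    using fun_of_le_sup_norm[OF x(1), of f] x(2) by (simp add: * abs_mult mult_left_mono)
  obtain y where y: "y \<in> {0..real n}" "sup_norm n f = \<bar>fun_of f y\<bar>"
    using sup_norm_attained by blast
  show "\<bar>c\<bar> * sup_norm n f \<le> sup_norm n (c *\<^sub>R f)"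
    using fun_of_le_sup_norm[OF y(1), of "c *\<^sub>R f"] y(2) by (simp add: * abs_mult)
qed

lemma L1_norm_nonneg [simp]: "0 \<le> L1_norm f"
  unfolding L1_norm_def set_lebesgue_integral_def by (intro integral_nonneg_AE) auto

lemma L1_norm_triangle: "L1_norm (f + g) \<le> L1_norm f + L1_norm g"
proof -
  have *: "fun_of (f + g) x = fun_of f x + fun_of g x" for x
    by transfer simp
  have "L1_norm (f + g) \<le> (LINT x:{0..}|lebesgue. \<bar>fun_of f x\<bar> + \<bar>fun_of g x\<bar>)"
    unfolding L1_norm_def
    by (intro set_integral_mono set_integrable_abs_fun_of set_integral_add) (auto simp: *)
  also have "\<dots> = L1_norm f + L1_norm g"
    unfolding L1_norm_def by (intro set_integral_add set_integrable_abs_fun_of)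
  finally show ?thesis .
qed

lemma L1_norm_scaleR: "L1_norm (c *\<^sub>R f) = \<bar>c\<bar> * L1_norm f"
proof -
  have "fun_of (c *\<^sub>R f) x = c * fun_of f x" for x
    by transfer simp
  then show ?thesis
    unfolding L1_norm_def by (simp add: abs_mult)
qed

(* Series indexed from 0, so the summand at n is the term with index Suc n >= 1. *)
definition dX :: "cont_L1 \<Rightarrow> cont_L1 \<Rightarrow> real" where
  "dX f g = L1_norm (f - g) +
     (\<Sum>n. 1 / 2 ^ Suc n * (sup_norm (Suc n) (f - g) / (1 + sup_norm (Suc n) (f - g))))"

lemma frac_mono: "0 \<le> s \<Longrightarrow> s \<le> t \<Longrightarrow> s / (1 + s) \<le> t / (1 + t)" for s t :: real
  by (simp add: field_simps)

lemma frac_add: "0 \<le> s \<Longrightarrow> 0 \<le> t \<Longrightarrow> (s + t) / (1 + (s + t)) \<le> s / (1 + s) + t / (1 + t)" for s t :: real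
proof -
  assume "0 \<le> s" "0 \<le> t"
  then have "s / (1 + (s + t)) \<le> s / (1 + s)" "t / (1 + (s + t)) \<le> t / (1 + t)"
    by (auto intro!: divide_left_mono)
  then show ?thesis by (simp add: add_divide_distrib)
qed

lemma frac_le_1: "0 \<le> s \<Longrightarrow> s / (1 + s) \<le> 1" for s :: real
  by simp

lemma dX_term_bound:
  "norm (1 / 2 ^ Suc n * (sup_norm (Suc n) f / (1 + sup_norm (Suc n) f))) \<le> (1 / 2) ^ Suc n"
proof -
  have *: "norm (1 / c * r) \<le> 1 / c" if "0 \<le> r" "r \<le> 1" "0 < c" for r c :: real
    using that by (simp add: divide_right_mono)
  show ?thesis
    unfolding power_one_over by (rule *) (auto intro: frac_le_1)
qed

lemma summable_dX:
  "summable (\<lambda>n. 1 / 2 ^ Suc n * (sup_norm (Suc n) f / (1 + sup_norm (Suc n) f)))"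
proof (rule summable_comparison_test')
  show "summable (\<lambda>n. (1 / 2 :: real) ^ Suc n)"
    by (subst summable_Suc_iff) (simp add: summable_geometric)
qed (rule dX_term_bound)

lemma dX_mono:
  assumes "L1_norm (f - g) \<le> L1_norm (f' - g')"
    and "\<And>n. sup_norm n (f - g) \<le> sup_norm n (f' - g')"
  shows "dX f g \<le> dX f' g'"
  unfolding dX_def
  by (intro add_mono assms suminf_le summable_dX mult_left_mono frac_mono) auto

lemma dX_add_le: "dX (f + g) 0 \<le> dX f 0 + dX g 0"
proof -
  let ?a = "\<lambda>f n. 1 / 2 ^ Suc n * (sup_norm (Suc n) f / (1 + sup_norm (Suc n) f))"
  have "?a (f + g) n \<le> ?a f n + ?a g n" for n
  proof -
    have "sup_norm (Suc n) (f + g) / (1 + sup_norm (Suc n) (f + g))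
        \<le> sup_norm (Suc n) f / (1 + sup_norm (Suc n) f) + sup_norm (Suc n) g / (1 + sup_norm (Suc n) g)"
      by (rule order_trans[OF frac_mono frac_add]) (auto intro: sup_norm_triangle)
    then show ?thesis
      unfolding distrib_left[symmetric] by (intro mult_left_mono) auto
  qed
  then have "(\<Sum>n. ?a (f + g) n) \<le> (\<Sum>n. ?a f n + ?a g n)"
    by (intro suminf_le summable_add summable_dX)
  also have "\<dots> = (\<Sum>n. ?a f n) + (\<Sum>n. ?a g n)"
    by (intro suminf_add[symmetric] summable_dX)
  finally show ?thesis
    using L1_norm_triangle[of f g] unfolding dX_def by simp
qed

lemma dX_diff: "dX f g = dX (f - g) 0"
  by (simp add: dX_def)

lemma dX_scaleR_le_1: "\<bar>c\<bar> \<le> 1 \<Longrightarrow> dX (c *\<^sub>R f) 0 \<le> dX f 0"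
  by (intro dX_mono) (auto simp: L1_norm_scaleR sup_norm_scaleR intro: mult_left_le_one_le)

lemma dX_minus: "dX (- f) 0 = dX f 0"
  using dX_scaleR_le_1[of "-1" f] dX_scaleR_le_1[of "-1" "- f"] by simp

lemma dX_commute: "dX f g = dX g f"
  using dX_minus[of "f - g"] by (simp add: dX_diff[of f g] dX_diff[of g f])

lemma dX_eq_0_iff: "dX f g = 0 \<longleftrightarrow> f = g"
proof
  let ?a = "\<lambda>n. 1 / 2 ^ Suc n * (sup_norm (Suc n) (f - g) / (1 + sup_norm (Suc n) (f - g)))"
  assume eq: "dX f g = 0"
  have nn: "0 \<le> ?a n" for n by simp
  have "0 \<le> (\<Sum>n. ?a n)"
    by (rule suminf_nonneg[OF summable_dX nn])
  with eq L1_norm_nonneg[of "f - g"] have "(\<Sum>n. ?a n) = 0"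
    unfolding dX_def by linarith
  then have *: "\<forall>n. ?a n = 0"
    using suminf_eq_zero_iff[OF summable_dX[of "f - g"] nn] by blast
  have 0: "sup_norm (Suc n) (f - g) = 0" for n
    using *[rule_format, of n] sup_norm_nonneg[of "Suc n" "f - g"] by (auto simp del: sup_norm_nonneg)
  show "f = g"
  proof (rule cont_L1_eqI)
    fix x :: real assume "x \<ge> 0"
    obtain n where "x \<le> real n" using real_arch_simple by blast
    then have "\<bar>fun_of (f - g) x\<bar> \<le> 0"
      using fun_of_le_sup_norm[of x "Suc n" "f - g"] 0[of n] \<open>x \<ge> 0\<close> by auto
    moreover have "fun_of (f - g) x = fun_of f x - fun_of g x" by transfer simp
    ultimately show "fun_of f x = fun_of g x" by simp
  qed
next
  assume "f = g"
  moreover have "L1_norm 0 = 0" "sup_norm n 0 = 0" for n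
    using L1_norm_scaleR[of 0 0] sup_norm_scaleR[of n 0 0] by simp_all
  ultimately show "dX f g = 0"
    by (simp add: dX_def)
qed

lemma dX_self [simp]: "dX f f = 0"
  by (simp add: dX_eq_0_iff)

instantiation cont_L1 :: metric_space
begin

definition dist_cont_L1 :: "cont_L1 \<Rightarrow> cont_L1 \<Rightarrow> real" where
  "dist_cont_L1 = dX"

definition uniformity_cont_L1 :: "(cont_L1 \<times> cont_L1) filter" where
  "uniformity_cont_L1 = (INF e\<in>{0 <..}. principal {(f, g). dist f g < e})"

definition open_cont_L1 :: "cont_L1 set \<Rightarrow> bool" where
  "open_cont_L1 U \<longleftrightarrow> (\<forall>f\<in>U. eventually (\<lambda>(f', g). f' = f \<longrightarrow> g \<in> U) uniformity)"

instance
proof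
  fix f g h :: cont_L1
  show "dist f g = 0 \<longleftrightarrow> f = g"
    by (simp add: dist_cont_L1_def dX_eq_0_iff)
  have "dX f g \<le> dX (f - h) 0 + dX (h - g) 0"
    using dX_add_le[of "f - h" "h - g"] by (simp add: dX_diff[of f g])
  then show "dist f g \<le> dist f h + dist g h"
    by (simp add: dist_cont_L1_def dX_diff[of f h] dX_commute[of g h] dX_diff[of h g])
qed (simp_all add: uniformity_cont_L1_def open_cont_L1_def)

end

lemma dX_scaleR_tendsto_0:
  assumes "(c \<longlongrightarrow> 0) F"
  shows "((\<lambda>x. dX (c x *\<^sub>R f) 0) \<longlongrightarrow> 0) F"
proof -
  let ?b = "\<lambda>n t. 1 / 2 ^ Suc n * (\<bar>t\<bar> * sup_norm (Suc n) f / (1 + \<bar>t\<bar> * sup_norm (Suc n) f))"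
  have "uniform_limit UNIV (\<lambda>N t. \<Sum>n<N. ?b n t) (\<lambda>t. \<Sum>n. ?b n t) sequentially"
  proof (rule Weierstrass_m_test)
    show "summable (\<lambda>n. (1 / 2 :: real) ^ Suc n)"
      by (subst summable_Suc_iff) (simp add: summable_geometric)
    show "norm (?b n t) \<le> (1 / 2) ^ Suc n" for n t
      using dX_term_bound[of n "t *\<^sub>R f"] by (simp add: sup_norm_scaleR)
  qed
  moreover have "continuous_on UNIV (?b n)" for n
  proof -
    have "1 + \<bar>t\<bar> * sup_norm (Suc n) f \<noteq> 0" for t
      using mult_nonneg_nonneg[of "\<bar>t\<bar>" "sup_norm (Suc n) f"] by fastforce
    then show ?thesis by (intro continuous_intros) auto
  qed
  ultimately have "continuous_on UNIV (\<lambda>t. \<Sum>n. ?b n t)"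
    by (intro uniform_limit_theorem[where F = sequentially])
       (auto intro!: always_eventually continuous_on_sum simp del: power_Suc)
  then have "continuous_on UNIV (\<lambda>t. \<bar>t\<bar> * L1_norm f + (\<Sum>n. ?b n t))"
    by (intro continuous_intros)
  moreover have "(\<lambda>t. \<bar>t\<bar> * L1_norm f + (\<Sum>n. ?b n t)) = (\<lambda>t. dX (t *\<^sub>R f) 0)"
    by (simp add: dX_def L1_norm_scaleR sup_norm_scaleR)
  ultimately have "isCont (\<lambda>t. dX (t *\<^sub>R f) 0) 0"
    by (simp add: continuous_on_eq_continuous_at)
  from isCont_tendsto_compose[OF this assms] show ?thesis
    by simp
qed

instance cont_L1 :: topological_real_vector
proof
  fix f g :: cont_L1 and c :: real
  have fst: "((\<lambda>x. fst x) \<longlongrightarrow> a) (nhds a \<times>\<^sub>F nhds b)"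
    and snd: "((\<lambda>x. snd x) \<longlongrightarrow> b) (nhds a \<times>\<^sub>F nhds b)"
    for a :: "'a::topological_space" and b :: "'b::topological_space"
    by (simp_all add: filterlim_fst filterlim_snd)
  have dist_0: "dist f g = dist (f - g) 0" for f g :: cont_L1
    unfolding dist_cont_L1_def by (rule dX_diff)
  show "LIM x (nhds f \<times>\<^sub>F nhds g). fst x + snd x :> nhds (f + g)"
  proof (rule metric_tendsto_imp_tendsto[where a = 0])
    show "((\<lambda>x. dist (fst x) f + dist (snd x) g) \<longlongrightarrow> 0) (nhds f \<times>\<^sub>F nhds g)"
      by (intro tendsto_add_zero tendsto_dist_iff[THEN iffD1] fst snd)
    have "dist (x + y) (f + g) \<le> dist x f + dist y g" for x y
      using dX_add_le[of "x - f" "y - g"]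
      unfolding dist_cont_L1_def dX_diff[of "x + y" "f + g"] dX_diff[of x f] dX_diff[of y g] add_diff_add .
    then show "\<forall>\<^sub>F x in nhds f \<times>\<^sub>F nhds g.
        dist (fst x + snd x) (f + g) \<le> dist (dist (fst x) f + dist (snd x) g) 0"
      by (intro always_eventually) (simp add: dist_real_def)
  qed
  show "(uminus \<longlongrightarrow> - f) (nhds f)"
  proof (rule metric_tendsto_imp_tendsto[where a = f])
    show "((\<lambda>x. x) \<longlongrightarrow> f) (nhds f)" by (simp add: filterlim_ident)
    have "dist (- x) (- f) = dist x f" for x
      using dX_minus[of "x - f"]
      unfolding dist_cont_L1_def dX_diff[of "- x" "- f"] dX_diff[of x f] by simp
    then show "\<forall>\<^sub>F x in nhds f. dist (- x) (- f) \<le> dist x f" by simp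
  qed
  show "LIM x (nhds c \<times>\<^sub>F nhds f). fst x *\<^sub>R snd x :> nhds (c *\<^sub>R f)"
  proof (rule metric_tendsto_imp_tendsto[where a = 0])
    let ?F = "nhds c \<times>\<^sub>F nhds f"
    let ?e = "\<lambda>x. dX ((fst x - c) *\<^sub>R f) 0 + (dX ((fst x - c) *\<^sub>R (snd x - f)) 0 + dX (c *\<^sub>R (snd x - f)) 0)"
    have d0: "0 \<le> dX h 0" for h using zero_le_dist[of h 0] by (simp add: dist_cont_L1_def)
    have scale: "((\<lambda>h. dX (c *\<^sub>R (h - f)) 0) \<longlongrightarrow> 0) (nhds f)" for c
    proof -
      obtain m :: nat where m: "\<bar>c\<bar> \<le> real m" using real_arch_simple by blast
      have nat_le: "dX (real m *\<^sub>R h) 0 \<le> real m * dX h 0" for m h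
      proof (induction m)
        case 0 show ?case by simp
      next
        case (Suc m)
        then show ?case
          using dX_add_le[of h "real m *\<^sub>R h"] by (simp add: algebra_simps scaleR_add_left)
      qed
      have le: "dX (c *\<^sub>R h) 0 \<le> real m * dX h 0" for h
      proof (rule order_trans[OF _ nat_le])
        show "dX (c *\<^sub>R h) 0 \<le> dX (real m *\<^sub>R h) 0"
          using m by (intro dX_mono) (auto simp: L1_norm_scaleR sup_norm_scaleR intro!: mult_right_mono)
      qed
      have "((\<lambda>h. dist h f) \<longlongrightarrow> 0) (nhds f)"
        by (intro tendsto_dist_iff[THEN iffD1]) (simp add: filterlim_ident)
      then have "((\<lambda>h. dX (h - f) 0) \<longlongrightarrow> 0) (nhds f)"
        unfolding dist_cont_L1_def dX_diff[of _ f] .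
      then have "((\<lambda>h. real m * dX (h - f) 0) \<longlongrightarrow> 0) (nhds f)"
        by (rule tendsto_mult_right_zero)
      then show ?thesis
        by (rule tendsto_sandwich[OF _ _ tendsto_const, rotated 2])
           (auto intro: always_eventually le d0)
    qed
    have "((\<lambda>x. fst x - c) \<longlongrightarrow> 0) ?F"
      using tendsto_diff[OF fst[of c f] tendsto_const[of c]] by simp
    then have 1: "((\<lambda>x. dX ((fst x - c) *\<^sub>R f) 0) \<longlongrightarrow> 0) ?F"
      by (rule dX_scaleR_tendsto_0)
    have 2: "((\<lambda>x. dX (c *\<^sub>R (snd x - f)) 0) \<longlongrightarrow> 0) ?F"
      using filterlim_compose[OF scale[of c] snd] .
    have 4: "((\<lambda>x. dX (1 *\<^sub>R (snd x - f)) 0) \<longlongrightarrow> 0) ?F"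
      using filterlim_compose[OF scale[of 1] snd] .
    have "\<forall>\<^sub>F x in ?F. dist (fst x) c < 1"
      using tendstoD[OF fst, of 1] by simp
    then have "\<forall>\<^sub>F x in ?F. dX ((fst x - c) *\<^sub>R (snd x - f)) 0 \<le> dX (1 *\<^sub>R (snd x - f)) 0"
      by eventually_elim (auto simp: dist_real_def intro!: dX_scaleR_le_1)
    then have 3: "((\<lambda>x. dX ((fst x - c) *\<^sub>R (snd x - f)) 0) \<longlongrightarrow> 0) ?F"
      by (intro tendsto_sandwich[OF _ _ tendsto_const 4]) (auto intro: always_eventually d0)
    show "(?e \<longlongrightarrow> 0) ?F"
      by (intro tendsto_add_zero 1 2 3)
    have "dist (t *\<^sub>R h) (c *\<^sub>R f)
        \<le> dX ((t - c) *\<^sub>R f) 0 + (dX ((t - c) *\<^sub>R (h - f)) 0 + dX (c *\<^sub>R (h - f)) 0)" for t h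
    proof -
      have "t *\<^sub>R h - c *\<^sub>R f = (t - c) *\<^sub>R f + ((t - c) *\<^sub>R (h - f) + c *\<^sub>R (h - f))"
        by (simp add: algebra_simps)
      then show ?thesis
        unfolding dist_cont_L1_def dX_diff[of "t *\<^sub>R h" "c *\<^sub>R f"]
        by (simp only:) (intro order_trans[OF dX_add_le] add_left_mono dX_add_le)
    qed
    then show "\<forall>\<^sub>F x in ?F. dist (fst x *\<^sub>R snd x) (c *\<^sub>R f) \<le> dist (?e x) 0"
      using d0 by (intro always_eventually allI) (simp add: dist_real_def)
  qed
qed

end

theory Submission
  imports Defs
begin

text \<open>
  A function of the space is unbounded exactly when its limit superior at infinity is infinite,
  since a continuous function is bounded on every compact interval. So the set in question is the
  complement of a vector subspace \<open>Y\<close>, the bounded functions, and the problem is to find a dense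
  subspace \<open>M\<close> of full dimension that meets \<open>Y\<close> only in \<open>0\<close>. Three facts give such an \<open>M\<close>.

  \<^item> \<open>Y\<close> is dense (\<open>closure_bounded_functions\<close>): clamping the values of \<open>f\<close> to \<open>[-n, n]\<close> changes
    nothing on a fixed compact interval once \<open>n\<close> is large, and the change in the \<open>L1\<close> norm tends to
    \<open>0\<close> by dominated convergence.

  \<^item> There is a family \<open>u t\<close>, \<open>0 < t < 1\<close>, that is linearly independent modulo \<open>Y\<close>
    (\<open>spike_fun_independent\<close>): multiply \<open>exp (t * x)\<close> by a fixed continuous function that is \<open>1\<close> at
    the natural numbers and vanishes off intervals around them whose lengths decay faster than
    \<open>exp x\<close> grows. At the natural numbers a linear combination is a sum of exponentials, which is
    unbounded unless it is trivial.

  \<^item> The space has at most the cardinality of the continuum (\<open>cont_L1_lepoll_reals\<close>), because a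
    continuous function is determined by its values at the rationals.

  They combine as follows (\<open>maximal_dense_lineable_Compl\<close>). By the third fact the index set \<open>(0, 1)\<close>
  is large enough to enumerate, as \<open>t\<close> varies, all pairs of an element \<open>y\<close> of \<open>Y\<close> and a natural
  number \<open>n\<close>. For such a \<open>t\<close> put \<open>x t = y + c *\<^sub>R u t\<close> with a scalar \<open>c \<noteq> 0\<close> so small that \<open>x t\<close> lies
  within \<open>1 / (n + 1)\<close> of \<open>y\<close>. Modulo \<open>Y\<close> the \<open>x t\<close> are nonzero multiples of the \<open>u t\<close>, so they
  are still independent modulo \<open>Y\<close>, and their span \<open>M\<close> meets \<open>Y\<close> only in \<open>0\<close>. The closure of \<open>M\<close>
  contains \<open>Y\<close>, hence everything. Finally, the \<open>x t\<close> form a basis of \<open>M\<close> that is as large as the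
  continuum, and no basis of the whole space can be larger.
\<close>

section \<open>Independence modulo a subspace\<close>

definition independent_modulo :: "'a::real_vector set \<Rightarrow> ('i \<Rightarrow> 'a) \<Rightarrow> 'i set \<Rightarrow> bool" where
  "independent_modulo Y u I \<longleftrightarrow>
     (\<forall>T b. finite T \<longrightarrow> T \<subseteq> I \<longrightarrow> (\<Sum>t\<in>T. b t *\<^sub>R u t) \<in> Y \<longrightarrow> (\<forall>t\<in>T. b t = 0))"

lemma independent_moduloD:
  "\<lbrakk>independent_modulo Y u I; finite T; T \<subseteq> I; (\<Sum>t\<in>T. b t *\<^sub>R u t) \<in> Y; t \<in> T\<rbrakk> \<Longrightarrow> b t = 0"
  unfolding independent_modulo_def by blast

text \<open>Modulo \<open>Y\<close> each vector of the new family is a nonzero multiple of the old one.\<close>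
lemma independent_modulo_perturb:
  assumes Y: "subspace Y" and u: "independent_modulo Y u I"
    and y: "\<And>t. t \<in> I \<Longrightarrow> y t \<in> Y" and c: "\<And>t. t \<in> I \<Longrightarrow> c t \<noteq> 0"
  shows "independent_modulo Y (\<lambda>t. y t + c t *\<^sub>R u t) I"
  unfolding independent_modulo_def
proof (intro allI impI ballI)
  fix T b t
  assume T: "finite T" "T \<subseteq> I" and t: "t \<in> T"
    and sum: "(\<Sum>t\<in>T. b t *\<^sub>R (y t + c t *\<^sub>R u t)) \<in> Y"
  have "(\<Sum>t\<in>T. b t *\<^sub>R y t) \<in> Y"
    using T y by (intro subspace_sum[OF Y] subspace_scale[OF Y]) auto
  with sum have "(\<Sum>t\<in>T. b t *\<^sub>R (y t + c t *\<^sub>R u t)) - (\<Sum>t\<in>T. b t *\<^sub>R y t) \<in> Y"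
    by (rule subspace_diff[OF Y])
  then have "(\<Sum>t\<in>T. (b t * c t) *\<^sub>R u t) \<in> Y"
    by (simp add: scaleR_add_right sum.distrib)
  from independent_moduloD[OF u T this t] c[of t] T t show "b t = 0" by auto
qed

lemma independent_modulo_inj_on:
  assumes Y: "subspace Y" and x: "independent_modulo Y x I"
  shows "inj_on x I"
proof (rule inj_onI, rule ccontr)
  fix s t assume st: "s \<in> I" "t \<in> I" "x s = x t" "s \<noteq> t"
  let ?b = "\<lambda>r. if r = s then 1 else - 1 :: real"
  have "(\<Sum>r\<in>{s, t}. ?b r *\<^sub>R x r) \<in> Y"
    using st subspace_0[OF Y] by simp
  then have "?b s = 0"
    by (intro independent_moduloD[OF x, of "{s, t}" ?b s]) (use st in auto)
  then show False by simp
qed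

lemma independent_modulo_image:
  assumes Y: "subspace Y" and x: "independent_modulo Y x I"
  shows "independent (x ` I)" and "span (x ` I) \<inter> Y = {0}"
proof -
  have inj: "inj_on x I" using assms by (rule independent_modulo_inj_on)
  have *: "r a = 0" if S: "finite S" "S \<subseteq> x ` I" "(\<Sum>a\<in>S. r a *\<^sub>R a) \<in> Y" "a \<in> S" for S r a
  proof -
    obtain T where T: "finite T" "T \<subseteq> I" "S = x ` T"
      using S(1,2) by (metis finite_subset_image)
    have "(\<Sum>t\<in>T. r (x t) *\<^sub>R x t) \<in> Y"
      using S(3) T by (simp add: sum.reindex inj_on_subset[OF inj])
    with independent_moduloD[OF x T(1,2)] S(4) T(3) show "r a = 0" by auto
  qed
  show "independent (x ` I)"
    unfolding dependent_explicit using * subspace_0[OF Y] by metis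
  have "v = 0" if v: "v \<in> span (x ` I)" "v \<in> Y" for v
  proof -
    obtain S r where "finite S" "S \<subseteq> x ` I" "v = (\<Sum>a\<in>S. r a *\<^sub>R a)"
      using v(1) unfolding span_explicit by auto
    with * v(2) show ?thesis by (metis (no_types, lifting) scaleR_zero_left sum.neutral)
  qed
  then show "span (x ` I) \<inter> Y = {0}"
    using subspace_0[OF Y] span_zero by blast
qed

section \<open>Dense lineability of the complement of a dense subspace\<close>

lemma add_small_multiple_near:
  fixes y u :: "'a::{metric_space, topological_real_vector}"
  assumes "0 < e"
  shows "\<exists>c. c \<noteq> 0 \<and> dist (y + c *\<^sub>R u) y < e"
proof -
  have "filterlim (\<lambda>c::real. (c, u)) (nhds 0 \<times>\<^sub>F nhds u) (at 0)"
    by (intro filterlim_Pair) (auto intro: tendsto_intros)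
  from filterlim_compose[OF tendsto_scaleR_Pair this]
  have "((\<lambda>c. c *\<^sub>R u) \<longlongrightarrow> 0) (at 0)" by simp
  from tendsto_add[OF tendsto_const this]
  have "((\<lambda>c. y + c *\<^sub>R u) \<longlongrightarrow> y) (at 0)" by simp
  from tendstoD[OF this assms]
  have "\<forall>\<^sub>F c in at 0. dist (y + c *\<^sub>R u) y < e \<and> c \<noteq> 0"
    by (intro eventually_conj) (auto simp: eventually_at_filter)
  then show ?thesis
    by (metis (mono_tags, lifting) eventually_happens trivial_limit_at)
qed

text \<open>
  The basis \<open>extend_basis B\<close> of the whole space contains \<open>B\<close>, and as a set of vectors it is no
  larger than the whole space, so by Schroeder-Bernstein the two bases are equipollent.
\<close>
lemma same_dimension_span_UNIV:
  fixes B :: "'a::real_vector set"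
  assumes "independent B" "(UNIV :: 'a set) \<lesssim> B"
  shows "same_dimension (span B) (UNIV :: 'a set)"
  unfolding same_dimension_def
proof (intro exI conjI)
  show "hamel_basis_of B (span B)"
    using assms by (simp add: hamel_basis_of_def)
  show "hamel_basis_of (extend_basis B) UNIV"
    using assms by (simp add: hamel_basis_of_def independent_extend_basis)
  show "B \<approx> extend_basis B"
  proof (rule lepoll_antisym)
    show "B \<lesssim> extend_basis B"
      using extend_basis_superset[OF assms(1)] by (rule subset_imp_lepoll)
    show "extend_basis B \<lesssim> B"
      using lepoll_trans[OF subset_imp_lepoll[OF subset_UNIV] assms(2)] .
  qed
qed

text \<open>
  The cardinality condition on \<open>I\<close> serves twice: the family must have enough members to place one
  near every element of \<open>Y\<close> at every scale, and their span must have full dimension.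
\<close>
lemma maximal_dense_lineable_Compl:
  fixes Y :: "'a::{metric_space, topological_real_vector} set" and u :: "'i \<Rightarrow> 'a"
  assumes Y: "subspace Y" and dense: "closure Y = UNIV"
    and u: "independent_modulo Y u I" and I: "infinite I" "(UNIV :: 'a set) \<lesssim> I"
  shows "maximal_dense_lineable (- Y)"
proof -
  have "Y \<times> (UNIV :: nat set) \<lesssim> I \<times> I"
    using I lepoll_trans[OF subset_imp_lepoll[OF subset_UNIV] I(2)]
    by (intro times_lepoll_mono) (auto simp: infinite_le_lepoll)
  also have "I \<times> I \<approx> I"
    using card_of_Times_same_infinite[OF I(1)] by (simp add: eqpoll_iff_card_of_ordIso)
  finally obtain g where g: "Y \<times> (UNIV :: nat set) \<subseteq> g ` I"
    unfolding lepoll_iff by blast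
  \<comment> \<open>Indices that \<open>g\<close> sends outside \<open>Y \<times> UNIV\<close> get the harmless base point \<open>0\<close>.\<close>
  define y where "y t = (if g t \<in> Y \<times> UNIV then fst (g t) else 0)" for t
  have y: "y t \<in> Y" for t
    using subspace_0[OF Y] by (auto simp: y_def mem_Times_iff)
  obtain c where c: "\<And>t. c t \<noteq> 0" "\<And>t. dist (y t + c t *\<^sub>R u t) (y t) < 1 / real (Suc (snd (g t)))"
    using add_small_multiple_near[of "1 / real (Suc (snd (g t)))" "y t" "u t" for t]
    by (metis divide_pos_pos of_nat_0_less_iff zero_less_Suc zero_less_one)
  define x where "x t = y t + c t *\<^sub>R u t" for t
  have x: "independent_modulo Y x I"
    unfolding x_def by (intro independent_modulo_perturb Y u y c)
  note ind = independent_modulo_image[OF Y x]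
  have "closure (span (x ` I)) = UNIV"
  proof -
    have "\<exists>v\<in>span (x ` I). dist v z < e" if "0 < e" for z e
    proof -
      have "z \<in> closure Y" using dense by simp
      then obtain w where w: "w \<in> Y" "dist w z < e / 2"
        using \<open>0 < e\<close> unfolding closure_approachable by (meson half_gt_zero)
      obtain n where n: "1 / real (Suc n) < e / 2"
        using \<open>0 < e\<close> nat_approx_posE[of "e / 2"] by auto
      have "(w, n) \<in> g ` I" using g w(1) by blast
      then obtain t where t: "t \<in> I" "g t = (w, n)" by force
      have "dist (x t) w < e / 2"
        using c(2)[of t] n t(2) w(1) by (simp add: x_def y_def)
      then have "dist (x t) z < e"
        using w(2) dist_triangle[of "x t" z w] by linarith
      then show ?thesis using t(1) by (blast intro: span_base)
    qed
    then show ?thesis by (auto simp: closure_approachable)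
  qed
  moreover have "I \<lesssim> x ` I"
    by (intro eqpoll_imp_lepoll eqpoll_sym[OF inj_on_image_eqpoll_self] independent_modulo_inj_on[OF Y x])
  then have "same_dimension (span (x ` I)) (UNIV :: 'a set)"
    by (intro same_dimension_span_UNIV ind lepoll_trans[OF I(2)])
  ultimately show ?thesis
    unfolding maximal_dense_lineable_def using ind(2) by (intro exI[of _ "span (x ` I)"]) auto
qed

section \<open>Continuous integrable functions on the half-line\<close>

lemma fun_of_plus [simp]: "fun_of (f + g) x = fun_of f x + fun_of g x"
  by transfer simp

lemma fun_of_diff [simp]: "fun_of (f - g) x = fun_of f x - fun_of g x"
  by transfer simp

lemma fun_of_scaleR [simp]: "fun_of (c *\<^sub>R f) x = c * fun_of f x"
  by transfer simp

lemma fun_of_zero [simp]: "fun_of 0 x = 0"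
  by transfer simp

lemma fun_of_sum [simp]: "fun_of (\<Sum>t\<in>T. h t) x = (\<Sum>t\<in>T. fun_of (h t) x)"
  by (induction T rule: infinite_finite_induct) auto

lemma fun_of_neg [simp]: "x < 0 \<Longrightarrow> fun_of f x = 0"
  using fun_of[of f] by auto

lemma set_borel_measurable_lebesgue_continuous:
  fixes f :: "real \<Rightarrow> real"
  assumes "continuous_on S f" "S \<in> sets borel"
  shows "set_borel_measurable lebesgue S f"
  using borel_measurable_continuous_on_indicator[OF assms(2,1)]
  unfolding set_borel_measurable_def by (intro measurable_completion) simp

text \<open>
  Measurability comes from continuity, so domination by an integrable function is all that is
  needed to see that a continuous function belongs to the space.
\<close>
lemma fun_of_Cont_L1:
  assumes f: "continuous_on {0..} f" and g: "g absolutely_integrable_on {0..}"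
    and le: "\<And>x. 0 \<le> x \<Longrightarrow> \<bar>f x\<bar> \<le> \<bar>g x\<bar>" and "0 \<le> x"
  shows "fun_of (Cont_L1 (\<lambda>x. if x < 0 then 0 else f x)) x = f x"
proof -
  have int: "f absolutely_integrable_on {0..}"
    by (rule set_integrable_bound[OF g set_borel_measurable_lebesgue_continuous[OF f]])
       (use le in auto)
  have "continuous_on {0..} (\<lambda>x. if x < 0 then 0 else f x)"
    by (rule continuous_on_eq[OF f]) auto
  moreover have "(\<lambda>x. if x < 0 then 0 else f x) absolutely_integrable_on {0..}"
    by (rule set_integrable_cong[THEN iffD1, OF refl refl _ int]) auto
  ultimately show ?thesis
    using \<open>0 \<le> x\<close> by (subst Cont_L1_inverse) auto
qed

section \<open>The dense subspace of bounded functions\<close>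

definition bounded_functions :: "cont_L1 set" where
  "bounded_functions = {f. bounded (range (fun_of f))}"

lemma bounded_functions_iff: "f \<in> bounded_functions \<longleftrightarrow> (\<exists>K. \<forall>x\<ge>0. \<bar>fun_of f x\<bar> \<le> K)"
proof -
  have "\<bar>fun_of f x\<bar> \<le> K" if "\<forall>x\<ge>0. \<bar>fun_of f x\<bar> \<le> K" for x K
    using that[rule_format, of 0] that[rule_format, of x] by (cases "x < 0") auto
  then show ?thesis
    unfolding bounded_functions_def bounded_iff by auto
qed

lemma subspace_bounded_functions: "subspace bounded_functions"
proof (rule subspaceI)
  show "0 \<in> bounded_functions"
    by (auto simp: bounded_functions_iff)
next
  fix f g assume "f \<in> bounded_functions" "g \<in> bounded_functions"
  then show "f + g \<in> bounded_functions"
    unfolding bounded_functions_iff fun_of_plus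
    by (meson abs_triangle_ineq add_mono order_trans)
next
  fix c f assume "f \<in> bounded_functions"
  then show "c *\<^sub>R f \<in> bounded_functions"
    unfolding bounded_functions_iff fun_of_scaleR abs_mult
    by (meson abs_ge_zero mult_left_mono)
qed

text \<open>
  A finite limit superior bounds the function near infinity, and continuity bounds it on the
  remaining compact interval.
\<close>
lemma Limsup_eq_infinity_iff_unbounded:
  "Limsup at_top (\<lambda>x. ereal \<bar>fun_of f x\<bar>) = \<infinity> \<longleftrightarrow> f \<notin> bounded_functions"
proof
  assume inf: "Limsup at_top (\<lambda>x. ereal \<bar>fun_of f x\<bar>) = \<infinity>"
  show "f \<notin> bounded_functions"
  proof
    assume "f \<in> bounded_functions"
    then obtain K where "\<forall>x\<ge>0. \<bar>fun_of f x\<bar> \<le> K"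
      unfolding bounded_functions_iff by blast
    then have "Limsup at_top (\<lambda>x. ereal \<bar>fun_of f x\<bar>) \<le> ereal K"
      by (intro Limsup_bounded eventually_at_top_linorderI[of 0]) auto
    with inf show False by simp
  qed
next
  assume unb: "f \<notin> bounded_functions"
  show "Limsup at_top (\<lambda>x. ereal \<bar>fun_of f x\<bar>) = \<infinity>"
  proof (rule ccontr)
    assume "Limsup at_top (\<lambda>x. ereal \<bar>fun_of f x\<bar>) \<noteq> \<infinity>"
    then have "Limsup at_top (\<lambda>x. ereal \<bar>fun_of f x\<bar>) < \<infinity>"
      by (simp add: less_top[symmetric])
    then obtain K where "Limsup at_top (\<lambda>x. ereal \<bar>fun_of f x\<bar>) < ereal K"
      using ereal_dense2 by blast
    then have "\<forall>\<^sub>F x in at_top. ereal \<bar>fun_of f x\<bar> < ereal K"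
      by (rule Limsup_lessD)
    then obtain a where a: "\<And>x. x \<ge> a \<Longrightarrow> \<bar>fun_of f x\<bar> < K"
      by (auto simp: eventually_at_top_linorder)
    obtain n where n: "a \<le> real n" using real_arch_simple by blast
    have "\<bar>fun_of f x\<bar> \<le> max K (sup_norm n f)" if "0 \<le> x" for x
      using fun_of_le_sup_norm[of x n f] a[of x] n that by (cases "x \<le> real n") auto
    with unb show False by (auto simp: bounded_functions_iff)
  qed
qed

lemma sup_norm_mono:
  assumes "k \<le> n" shows "sup_norm k f \<le> sup_norm n f"
proof -
  obtain x where "x \<in> {0..real k}" "sup_norm k f = \<bar>fun_of f x\<bar>"
    using sup_norm_attained by blast
  with assms fun_of_le_sup_norm[of x n f] show ?thesis by auto
qed

text \<open>
  The first \<open>N\<close> terms of the series in the metric vanish, and the others are at most those of a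
  geometric series.
\<close>
lemma dX_le_if_zero_on_interval:
  assumes "sup_norm N h = 0"
  shows "dX h 0 \<le> L1_norm h + (1 / 2) ^ N"
proof -
  let ?a = "\<lambda>n. 1 / 2 ^ Suc n * (sup_norm (Suc n) h / (1 + sup_norm (Suc n) h))"
  have 0: "?a n = 0" if "n < N" for n
  proof -
    have "sup_norm (Suc n) h \<le> 0"
      using sup_norm_mono[of "Suc n" N h] assms that by simp
    then have "sup_norm (Suc n) h = 0" by (intro antisym) auto
    then show ?thesis by simp
  qed
  have tail: "(\<lambda>n. (1 / 2 :: real) ^ N * (1 / 2) ^ Suc n) sums ((1 / 2) ^ N * 1)"
    by (intro sums_mult power_half_series)
  have "(\<Sum>n. ?a n) = (\<Sum>n. ?a (n + N)) + (\<Sum>n<N. ?a n)"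
    by (intro suminf_split_initial_segment summable_dX)
  also have "(\<Sum>n<N. ?a n) = 0"
    using 0 by (intro sum.neutral) blast
  also have "(\<Sum>n. ?a (n + N)) + 0 = (\<Sum>n. ?a (n + N))"
    by (rule add_0_right)
  also have "\<dots> \<le> (\<Sum>n. (1 / 2 :: real) ^ N * (1 / 2) ^ Suc n)"
  proof (rule suminf_le)
    show "?a (n + N) \<le> (1 / 2) ^ N * (1 / 2) ^ Suc n" for n
      using abs_le_D1[OF dX_term_bound[of "n + N" h, unfolded real_norm_def]]
      by (simp add: power_add mult_ac)
    show "summable (\<lambda>n. ?a (n + N))"
      using summable_dX by (rule summable_ignore_initial_segment)
    show "summable (\<lambda>n. (1 / 2 :: real) ^ N * (1 / 2) ^ Suc n)"
      using tail by (rule sums_summable)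
  qed
  also have "\<dots> = (1 / 2) ^ N"
    using sums_unique[OF tail] by simp
  finally show ?thesis
    by (simp add: dX_def)
qed

definition clamp_cont_L1 :: "real \<Rightarrow> cont_L1 \<Rightarrow> cont_L1" where
  "clamp_cont_L1 K f = Cont_L1 (\<lambda>x. if x < 0 then 0 else max (- K) (min K (fun_of f x)))"

lemma fun_of_clamp:
  assumes "0 \<le> K" "0 \<le> x"
  shows "fun_of (clamp_cont_L1 K f) x = max (- K) (min K (fun_of f x))"
  unfolding clamp_cont_L1_def
  by (rule fun_of_Cont_L1[OF _ absolutely_integrable_fun_of[of f]])
     (use assms in \<open>auto intro!: continuous_intros continuous_on_fun_of\<close>)

text \<open>
  Dominated convergence: the difference is bounded by \<open>\<bar>f\<bar>\<close>, and at each point it vanishes as soon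
  as the clamping level exceeds the value there.
\<close>
lemma L1_norm_clamp_tendsto:
  "(\<lambda>n. L1_norm (f - clamp_cont_L1 (real n) f)) \<longlonglongrightarrow> 0"
proof -
  let ?g = "\<lambda>n x. indicator {0..} x *\<^sub>R \<bar>fun_of (f - clamp_cont_L1 (real n) f) x\<bar>"
  have "(\<lambda>n. \<integral>x. ?g n x \<partial>lebesgue) \<longlonglongrightarrow> integral\<^sup>L lebesgue (\<lambda>x :: real. 0)"
  proof (rule integral_dominated_convergence
      [where M = lebesgue and s = ?g and f = "\<lambda>_. 0"
        and w = "\<lambda>x. indicator {0..} x *\<^sub>R \<bar>fun_of f x\<bar>"])
    show "integrable lebesgue (\<lambda>x. indicator {0..} x *\<^sub>R \<bar>fun_of f x\<bar>)"
      using set_integrable_abs_fun_of[of f] unfolding set_integrable_def .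
    show "?g n \<in> borel_measurable lebesgue" for n
      using set_integrable_abs_fun_of[of "f - clamp_cont_L1 (real n) f"]
      unfolding set_integrable_def by (rule borel_measurable_integrable)
    show "AE x in lebesgue. (\<lambda>n. ?g n x) \<longlonglongrightarrow> 0"
    proof (intro AE_I2)
      fix x :: real
      obtain m where m: "\<bar>fun_of f x\<bar> \<le> real m" using real_arch_simple by blast
      have "?g n x = 0" if "n \<ge> m" for n
        using m that by (cases "0 \<le> x") (auto simp: fun_of_clamp)
      then show "(\<lambda>n. ?g n x) \<longlonglongrightarrow> 0"
        by (intro tendsto_eventually eventually_sequentiallyI)
    qed
    show "AE x in lebesgue. norm (?g n x) \<le> indicator {0..} x *\<^sub>R \<bar>fun_of f x\<bar>" for n
      by (intro AE_I2) (auto simp: fun_of_clamp indicator_def)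
  qed simp
  then show ?thesis
    by (simp add: L1_norm_def set_lebesgue_integral_def)
qed

lemma closure_bounded_functions: "closure bounded_functions = UNIV"
proof -
  have "\<exists>g\<in>bounded_functions. dist g f < e" if "0 < e" for f e
  proof -
    obtain N where N: "(1 / 2) ^ N < e / 2"
      using real_arch_pow_inv[of "e / 2" "1 / 2"] \<open>0 < e\<close> by auto
    have "\<forall>\<^sub>F n in sequentially. L1_norm (f - clamp_cont_L1 (real n) f) < e / 2"
      using order_tendstoD(2)[OF L1_norm_clamp_tendsto, of "e / 2" f] \<open>0 < e\<close> by simp
    moreover have "\<forall>\<^sub>F n in sequentially. sup_norm N f \<le> real n"
      using filterlim_real_sequentially by (simp add: filterlim_at_top)
    ultimately have "\<forall>\<^sub>F n in sequentially.
        L1_norm (f - clamp_cont_L1 (real n) f) < e / 2 \<and> sup_norm N f \<le> real n"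
      by (rule eventually_conj)
    then obtain n where n: "L1_norm (f - clamp_cont_L1 (real n) f) < e / 2" "sup_norm N f \<le> real n"
      using eventually_happens'[OF sequentially_bot] by blast
    let ?g = "clamp_cont_L1 (real n) f"
    obtain x where x: "x \<in> {0..real N}" "sup_norm N (f - ?g) = \<bar>fun_of (f - ?g) x\<bar>"
      using sup_norm_attained by blast
    have "sup_norm N (f - ?g) = 0"
      using x n(2) fun_of_le_sup_norm[OF x(1), of f] by (auto simp: fun_of_clamp)
    from dX_le_if_zero_on_interval[OF this] have "dist ?g f < e"
      using n(1) N by (simp add: dist_cont_L1_def dX_commute[of _ f] dX_diff[of f])
    moreover have "?g \<in> bounded_functions"
      unfolding bounded_functions_iff
      by (intro exI[of _ "real n"]) (auto simp: fun_of_clamp)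
    ultimately show ?thesis by blast
  qed
  then show ?thesis by (auto simp: closure_approachable)
qed

section \<open>A continuum of functions independent modulo the bounded ones\<close>

text \<open>
  The factor \<open>3\<close> makes the spike at \<open>n\<close> so narrow, of width about \<open>exp (- 3 * n)\<close>, that even
  \<open>exp x * spikes x\<close> is integrable.
\<close>
definition spikes :: "real \<Rightarrow> real" where
  "spikes x = max 0 (1 - exp (3 * x) * infdist x \<nat>)"

lemma spikes_of_nat [simp]: "spikes (real n) = 1"
  by (simp add: spikes_def)

lemma spikes_bounds: "0 \<le> spikes x" "spikes x \<le> 1"
  by (auto simp: spikes_def infdist_nonneg)

lemma continuous_on_spikes: "continuous_on S spikes"
  unfolding spikes_def by (intro continuous_intros)

text \<open>
  A point where \<open>spikes\<close> does not vanish is closer than \<open>exp (- 3 * x) \<le> 1\<close> to some natural number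
  \<open>n\<close>. Then \<open>x > n - 1\<close>, which replaces the radius by one depending on \<open>n\<close> only.
\<close>
lemma spikes_support:
  assumes "0 \<le> x" "spikes x \<noteq> 0"
  shows "\<exists>n::nat. x \<in> {real n - exp (3 - 3 * real n)..real n + exp (3 - 3 * real n)} \<and> x \<le> real n + 1"
proof -
  have "exp (3 * x) * infdist x \<nat> < 1"
    using assms(2) by (auto simp: spikes_def max_def split: if_splits)
  then have "infdist x \<nat> < exp (- (3 * x))"
    by (simp add: exp_minus field_simps)
  moreover have "(\<nat> :: real set) \<noteq> {}" by auto
  ultimately have "(INF a\<in>\<nat>. dist x a) < exp (- (3 * x))"
    by (simp add: infdist_notempty)
  then obtain n :: nat where n: "dist x (real n) < exp (- (3 * x))"
    using cInf_lessD[of "dist x ` \<nat>"] by (auto elim: Nats_cases)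
  have "exp (- (3 * x)) \<le> 1" using assms(1) by simp
  with n have "\<bar>x - real n\<bar> < 1" unfolding dist_real_def by linarith
  moreover from this have "exp (- (3 * x)) \<le> exp (3 - 3 * real n)" by simp
  ultimately show ?thesis
    using n unfolding dist_real_def atLeastAtMost_iff by (intro exI[of _ n] conjI) linarith+
qed

text \<open>
  The function is dominated by a sum of multiples of indicators: \<open>exp (n + 1)\<close> on the interval of
  radius \<open>exp (3 - 3 * n)\<close> around \<open>n\<close>. The integrals of these form a geometric series of ratio
  \<open>exp (- 2)\<close>.
\<close>
lemma integrable_exp_spikes: "(\<lambda>x. exp x * spikes x) absolutely_integrable_on {0..}"
proof -
  let ?f = "\<lambda>x. indicator {0..} x *\<^sub>R (exp x * spikes x)"
  let ?J = "\<lambda>n. {real n - exp (3 - 3 * real n)..real n + exp (3 - 3 * real n)}"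
  let ?F = "\<lambda>n x. ennreal (exp (real n + 1)) * indicator (?J n) x"
  have meas: "?f \<in> borel_measurable lebesgue"
    unfolding set_borel_measurable_def[symmetric]
    by (intro set_borel_measurable_lebesgue_continuous continuous_intros continuous_on_spikes) auto
  have le: "ennreal (norm (?f x)) \<le> (\<Sum>n. ?F n x)" for x
  proof (cases "0 \<le> x \<and> spikes x \<noteq> 0")
    case True
    then obtain n where n: "x \<in> ?J n" "x \<le> real n + 1"
      using spikes_support by blast
    have "exp x * spikes x \<le> exp (real n + 1) * 1"
      using n(2) by (intro mult_mono) (auto simp: spikes_bounds)
    then have "ennreal (norm (?f x)) \<le> ?F n x"
      using True n(1) by (auto simp: spikes_bounds abs_mult intro!: ennreal_leI)
    also have "\<dots> \<le> (\<Sum>n. ?F n x)"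
      using sum_le_suminf[OF summableI, of "{n}" "\<lambda>n. ?F n x"]
      by (simp only: sum.insert finite.intros sum.empty empty_iff add_0_right zero_le simp_thms)
    finally show ?thesis .
  qed auto
  have "(\<integral>\<^sup>+x. ennreal (norm (?f x)) \<partial>lebesgue) \<le> (\<integral>\<^sup>+x. (\<Sum>n. ?F n x) \<partial>lebesgue)"
    by (intro nn_integral_mono le)
  also have "\<dots> = (\<Sum>n. \<integral>\<^sup>+x. ?F n x \<partial>lebesgue)"
    by (intro nn_integral_suminf measurable_completion) measurable
  also have "\<dots> = (\<Sum>n. ennreal (2 * exp 4 * exp (- 2) ^ n))"
  proof (intro suminf_cong)
    fix n
    have *: "exp (real n + 1) * (2 * exp (3 - 3 * real n)) = 2 * exp 4 * exp (- 2) ^ n"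
      unfolding exp_of_nat_mult[symmetric] mult.left_commute[of _ 2] mult.assoc exp_add[symmetric]
      by simp
    have "(\<integral>\<^sup>+x. ?F n x \<partial>lebesgue) = ennreal (exp (real n + 1)) * ennreal (2 * exp (3 - 3 * real n))"
      by (subst nn_integral_cmult_indicator) auto
    also have "ennreal (exp (real n + 1)) * ennreal (2 * exp (3 - 3 * real n))
        = ennreal (2 * exp 4 * exp (- 2) ^ n)"
      by (subst ennreal_mult[symmetric]) (auto simp: *)
    finally show "(\<integral>\<^sup>+x. ?F n x \<partial>lebesgue) = ennreal (2 * exp 4 * exp (- 2) ^ n)" .
  qed
  also have "\<dots> < \<infinity>"
    unfolding infinity_ennreal_def less_top[symmetric]
    by (intro ennreal_suminf_neq_top summable_mult summable_geometric) auto
  finally have "(\<integral>\<^sup>+x. ennreal (norm (?f x)) \<partial>lebesgue) < \<infinity>" .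
  with meas show ?thesis
    unfolding set_integrable_def by (intro integrableI_bounded)
qed

definition spike_fun :: "real \<Rightarrow> cont_L1" where
  "spike_fun t = Cont_L1 (\<lambda>x. if x < 0 then 0 else exp (t * x) * spikes x)"

lemma fun_of_spike_fun:
  assumes "t \<le> 1" "0 \<le> x"
  shows "fun_of (spike_fun t) x = exp (t * x) * spikes x"
  unfolding spike_fun_def
proof (rule fun_of_Cont_L1[OF _ integrable_exp_spikes])
  fix x :: real assume "0 \<le> x"
  then have "exp (t * x) * spikes x \<le> exp x * spikes x"
    using mult_right_mono[OF assms(1), of x] by (intro mult_right_mono) (auto simp: spikes_bounds)
  then show "\<bar>exp (t * x) * spikes x\<bar> \<le> \<bar>exp x * spikes x\<bar>"
    by (simp add: abs_mult spikes_bounds)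
qed (auto intro!: continuous_intros continuous_on_spikes assms)

text \<open>
  Divide the sum by its fastest growing exponential with nonzero coefficient, \<open>exp (m * n)\<close>. The
  quotient tends to \<open>b m\<close>, but also to \<open>0\<close> if the sum is bounded.
\<close>
lemma bounded_exponential_sum:
  fixes b :: "real \<Rightarrow> real"
  assumes T: "finite T" "\<And>t. t \<in> T \<Longrightarrow> 0 < t"
    and K: "\<And>n::nat. \<bar>\<Sum>t\<in>T. b t * exp (t * real n)\<bar> \<le> K"
    and t: "t \<in> T"
  shows "b t = 0"
proof (rule ccontr)
  assume "b t \<noteq> 0"
  define S where "S = {t\<in>T. b t \<noteq> 0}"
  define m where "m = Max S"
  have S: "finite S" "S \<noteq> {}" "\<And>t. t \<in> S \<Longrightarrow> t \<le> m"
    using T(1) t \<open>b t \<noteq> 0\<close> by (auto simp: S_def m_def)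
  have m: "m \<in> S" using S(1,2) by (simp add: m_def)
  then have "0 < m" "b m \<noteq> 0" using T(2) by (auto simp: S_def)
  let ?q = "\<lambda>n. exp (- m * real n) * (\<Sum>t\<in>T. b t * exp (t * real n))"
  have decay: "(\<lambda>n. exp (- c * real n)) \<longlonglongrightarrow> 0" if "0 < c" for c
  proof -
    have "(\<lambda>n. exp (- c) ^ n) \<longlonglongrightarrow> 0" using that by (intro LIMSEQ_realpow_zero) auto
    then show ?thesis by (simp only: exp_of_nat_mult[symmetric] mult.commute)
  qed
  have q: "?q n = (\<Sum>t\<in>S. b t * exp (- (m - t) * real n))" for n
  proof -
    have "exp (- (m - t) * real n) = exp (- m * real n) * exp (t * real n)" for t
      by (simp add: exp_add[symmetric] left_diff_distrib)
    then have "?q n = (\<Sum>t\<in>T. b t * exp (- (m - t) * real n))"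
      by (simp add: sum_distrib_left mult.left_commute)
    also have "\<dots> = (\<Sum>t\<in>S. b t * exp (- (m - t) * real n))"
      using T(1) by (intro sum.mono_neutral_right) (auto simp: S_def)
    finally show ?thesis .
  qed
  have "(\<lambda>n. \<Sum>t\<in>S. b t * exp (- (m - t) * real n)) \<longlonglongrightarrow> (\<Sum>t\<in>S. if t = m then b t else 0)"
  proof (intro tendsto_sum)
    fix t assume "t \<in> S"
    show "(\<lambda>n. b t * exp (- (m - t) * real n)) \<longlonglongrightarrow> (if t = m then b t else 0)"
    proof (cases "t = m")
      case False
      with S(3)[OF \<open>t \<in> S\<close>] have "0 < m - t" by simp
      from tendsto_mult_right_zero[OF decay[OF this]] False show ?thesis by simp
    qed simp
  qed
  then have "?q \<longlonglongrightarrow> b m"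
    using S(1) m by (simp only: q) simp
  moreover have "?q \<longlonglongrightarrow> 0"
  proof (rule Lim_null_comparison)
    show "\<forall>\<^sub>F n in sequentially. norm (?q n) \<le> exp (- m * real n) * K"
      using K by (intro always_eventually allI) (simp only: real_norm_def abs_mult abs_exp_cancel
        mult_le_cancel_left_pos exp_gt_zero)
    show "(\<lambda>n. exp (- m * real n) * K) \<longlonglongrightarrow> 0"
      using decay[OF \<open>0 < m\<close>] by (rule tendsto_mult_left_zero)
  qed
  ultimately show False
    using LIMSEQ_unique \<open>b m \<noteq> 0\<close> by blast
qed

lemma spike_fun_independent: "independent_modulo bounded_functions spike_fun {0<..<1}"
  unfolding independent_modulo_def
proof (intro allI impI ballI)
  fix T :: "real set" and b t
  assume T: "finite T" "T \<subseteq> {0<..<1}" "t \<in> T"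
    and "(\<Sum>t\<in>T. b t *\<^sub>R spike_fun t) \<in> bounded_functions"
  then obtain K where K: "\<And>x. 0 \<le> x \<Longrightarrow> \<bar>\<Sum>t\<in>T. b t * fun_of (spike_fun t) x\<bar> \<le> K"
    by (auto simp: bounded_functions_iff)
  have "(\<Sum>t\<in>T. b t * fun_of (spike_fun t) (real n)) = (\<Sum>t\<in>T. b t * exp (t * real n))" for n
    using T(2) by (intro sum.cong) (auto simp: fun_of_spike_fun)
  then have "\<bar>\<Sum>t\<in>T. b t * exp (t * real n)\<bar> \<le> K" for n
    using K[of "real n"] by simp
  with T show "b t = 0"
    by (intro bounded_exponential_sum[of T b K t]) auto
qed

section \<open>The cardinality of the space\<close>

lemma cont_L1_eqI_rat:
  assumes eq: "\<And>q. 0 \<le> q \<Longrightarrow> fun_of f (of_rat q) = fun_of g (of_rat q)"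
  shows "f = g"
proof (rule cont_L1_eqI)
  fix x :: real assume "0 \<le> x"
  let ?S = "{0..} \<inter> \<rat> :: real set"
  have "x \<in> closure ?S"
    unfolding closure_approachable
  proof (intro allI impI)
    fix e :: real assume "0 < e"
    then obtain r where "r \<in> \<rat>" "x < r" "r < x + e"
      using Rats_dense_in_real[of x "x + e"] by (meson less_add_same_cancel1)
    with \<open>0 \<le> x\<close> show "\<exists>y\<in>?S. dist y x < e"
      by (intro bexI[of _ r]) (simp_all add: dist_real_def)
  qed
  moreover have "continuous_on (closure ?S) (fun_of (f - g))"
    by (rule continuous_on_subset[OF continuous_on_fun_of closure_minimal[OF Int_lower1 closed_atLeast]])
  moreover have "fun_of (f - g) y = 0" if "y \<in> ?S" for y
  proof -
    have "y \<in> \<rat>" using that by blast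
    then obtain q where q: "y = of_rat q" by (rule Rats_cases)
    with that have "0 \<le> q" by simp
    from eq[OF this] show ?thesis unfolding q fun_of_diff by (rule right_minus_eq[THEN iffD2])
  qed
  ultimately have "fun_of (f - g) x = 0"
    using continuous_constant_on_closure[of ?S "fun_of (f - g)" 0 x] by blast
  then show "fun_of f x = fun_of g x" by simp
qed

text \<open>
  A function is encoded by the set of pairs of rationals \<open>(p, q)\<close> that lie strictly above its graph.
  This set determines the values at all rationals \<open>p \<ge> 0\<close>, hence the function, and it is a subset
  of a countable set.
\<close>
lemma cont_L1_lepoll_reals: "(UNIV :: cont_L1 set) \<lesssim> (UNIV :: real set)"
proof -
  define G where "G f = {(p :: rat, q :: rat). 0 \<le> p \<and> fun_of f (of_rat p) < of_rat q}" for f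
  have "inj G"
  proof (rule injI, rule cont_L1_eqI_rat)
    fix f g and p :: rat assume "G f = G g" "0 \<le> p"
    then have iff: "fun_of f (of_rat p) < of_rat q \<longleftrightarrow> fun_of g (of_rat p) < of_rat q" for q
      unfolding G_def set_eq_iff by (auto dest: spec[of _ "(p, q)"])
    show "fun_of f (of_rat p) = fun_of g (of_rat p)"
    proof (rule antisym)
      show "fun_of f (of_rat p) \<le> fun_of g (of_rat p)"
        using iff of_rat_dense[of "fun_of g (of_rat p)" "fun_of f (of_rat p)"]
        by (meson not_le order.asym)
      show "fun_of g (of_rat p) \<le> fun_of f (of_rat p)"
        using iff of_rat_dense[of "fun_of f (of_rat p)" "fun_of g (of_rat p)"]
        by (meson not_le order.asym)
    qed
  qed
  moreover have "inj (image (to_nat :: rat \<times> rat \<Rightarrow> nat))"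
    by (rule injI) (rule inj_image_eq_iff[OF inj_to_nat, THEN iffD1])
  ultimately have "inj (image to_nat \<circ> G)"
    by (intro inj_compose)
  then have "(UNIV :: cont_L1 set) \<lesssim> (UNIV :: nat set set)"
    unfolding lepoll_def by (intro exI conjI subset_UNIV)
  also have "\<dots> \<approx> (UNIV :: real set)"
    by (rule nat_sets_eqpoll_reals)
  finally show ?thesis .
qed

section \<open>Unbounded continuous integrable functions\<close>

theorem theorem2p4:
  shows "maximal_dense_lineable
    {f :: cont_L1. Limsup at_top (\<lambda>x. ereal \<bar>fun_of f x\<bar>) = \<infinity>}"
proof -
  have "{0<..<1 :: real} \<approx> (UNIV :: real set)"
    by (simp add: open_interval_eqpoll_reals)
  then have "(UNIV :: cont_L1 set) \<lesssim> {0<..<1 :: real}"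
    by (rule lepoll_trans2[OF cont_L1_lepoll_reals eqpoll_sym])
  then have "maximal_dense_lineable (- bounded_functions)"
    by (intro maximal_dense_lineable_Compl[OF subspace_bounded_functions
          closure_bounded_functions spike_fun_independent]) auto
  moreover have "- bounded_functions = {f. Limsup at_top (\<lambda>x. ereal \<bar>fun_of f x\<bar>) = \<infinity>}"
    by (auto simp: Limsup_eq_infinity_iff_unbounded)
  ultimately show ?thesis by simp
qed

end
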